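(* Let $f,g:\mathbb{C}\to\mathbb{C}$ be entire functions such that $f$ is of minimal exponential type and $g$ is of finite exponential type, and suppose that $$\sup_{z\in\mathbb{C}}\min\{|f(z)|,|g(z)|\}\le 1.$$ Then either $f$ or $g$ is constant.
   Context: An entire function $F$ is of finite exponential type if there are constants $A,B>0$ with $|F(z)|\le A e^{B|z|}$ for all $z\in\mathbb{C}$. It is of minimal exponential type if for every $\varepsilon>0$ there is $A_\varepsilon>0$ with $|F(z)|\le A_\varepsilon e^{\varepsilon|z|}$ for all $z\in\mathbb{C}$. *)

theory Defs
  imports "HOL-Complex_Analysis.Complex_Analysis"
begin

text \<open>The two growth conditions below are applied to entire functions, i.e. to
  functions that are holomorphic on \<^term>\<open>UNIV\<close>; entireness is a separate hypothesis.\<close>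

definition finite_exponential_type :: "(complex \<Rightarrow> complex) \<Rightarrow> bool" where
  "finite_exponential_type F \<longleftrightarrow>
     (\<exists>A>0. \<exists>B>0. \<forall>z. norm (F z) \<le> A * exp (B * norm z))"

definition minimal_exponential_type :: "(complex \<Rightarrow> complex) \<Rightarrow> bool" where
  "minimal_exponential_type F \<longleftrightarrow>
     (\<forall>\<epsilon>>0. \<exists>A>0. \<forall>z. norm (F z) \<le> A * exp (\<epsilon> * norm z))"

end

theory Submission
  imports Defs
begin

text \<open>Carleman's method. The sets \<open>\<bar>f\<bar> > 1\<close> and \<open>\<bar>g\<bar> > 1\<close> are disjoint, so the nonnegative
  functions \<open>u\<close>, \<open>v\<close> obtained from \<open>log\<^sup>+ \<bar>f\<bar>\<^sup>2\<close>, \<open>log\<^sup>+ \<bar>g\<bar>\<^sup>2\<close> by a \<open>C\<^sup>2\<close> smoothing that keeps them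
  subharmonic have disjoint supports. Put \<open>m\<^sub>u t = \<integral> u\<^sup>2\<close> over the circle of radius \<open>e\<^sup>t\<close> about a
  point where \<open>\<bar>f\<bar>, \<bar>g\<bar> \<le> 1\<close>. If \<open>u > 0\<close> on a set of angular measure \<open>\<theta>\<^sub>u\<close> of this circle,
  subharmonicity and Wirtinger's inequality give \<open>m\<^sub>u'' \<ge> (2 \<pi> / \<theta>\<^sub>u) m\<^sub>u'\<close>, and likewise for \<open>v\<close>. Since
  \<open>\<theta>\<^sub>u + \<theta>\<^sub>v \<le> 2 \<pi>\<close>, we get \<open>(log (m\<^sub>u' m\<^sub>v'))' \<ge> 4\<close>, so \<open>m\<^sub>u m\<^sub>v\<close> grows at least like
  \<open>e\<^bsup>4t\<^esup>\<close>. But the growth conditions on \<open>f\<close> and \<open>g\<close> make it \<open>o(e\<^bsup>4t\<^esup>)\<close>.\<close>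

subsection \<open>Integral inequalities on the circle\<close>

text \<open>Multiplying \<open>u\<^sup>2\<close> by \<open>\<alpha> cot \<sigma>\<close> with \<open>\<sigma>' = \<alpha>\<close> on the support of \<open>u\<close> completes the square in
  \<open>u'\<^sup>2 - \<alpha>\<^sup>2 u\<^sup>2\<close>. Here \<open>\<sigma>\<close> measures the support only approximately, through
  \<open>min 1 (u / \<epsilon>)\<close>, so that it is differentiable; \<open>\<alpha> < pi / \<theta>\<close> leaves room for \<open>\<delta>\<close> to keep
  \<open>\<sigma>\<close> away from the poles of the cotangent.\<close>

lemma wirtinger_support:
  fixes u u' :: "real \<Rightarrow> real"
  assumes ab: "a \<le> b"
    and du: "\<And>x. (u has_real_derivative u' x) (at x)"
    and cu': "continuous_on UNIV u'"
    and nonneg: "\<And>x. 0 \<le> u x" and ends: "u a = 0" "u b = 0"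
    and \<theta>: "0 < \<theta>" "measure lebesgue ({a..b} \<inter> {x. 0 < u x}) \<le> \<theta>"
  shows "(pi / \<theta>)\<^sup>2 * integral {a..b} (\<lambda>x. (u x)\<^sup>2) \<le> integral {a..b} (\<lambda>x. (u' x)\<^sup>2)"
proof -
  have cu: "continuous_on S u" for S
    using du by (meson DERIV_continuous_on has_field_derivative_at_within)
  have cu'S: "continuous_on S u'" for S
    using cu' continuous_on_subset by blast
  have iu: "(\<lambda>x. (u x)\<^sup>2) integrable_on {a..b}" "(\<lambda>x. (u' x)\<^sup>2) integrable_on {a..b}"
    by (intro integrable_continuous_real continuous_intros cu cu'S)+
  define I where "I = integral {a..b} (\<lambda>x. (u x)\<^sup>2)"
  define I' where "I' = integral {a..b} (\<lambda>x. (u' x)\<^sup>2)"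
  \<comment> \<open>The last term is the cost of the cut-off in \<open>\<psi>\<close> below. It
    disappears as \<open>\<epsilon>\<close> tends to 0 with \<open>\<alpha>\<close> fixed;
    afterwards \<open>\<alpha>\<close> is sent to \<open>pi / \<theta>\<close>.\<close>
  have step: "\<alpha>\<^sup>2 * I \<le> I' + (b - a) * (\<alpha>\<^sup>2 * \<epsilon>\<^sup>2 / (sin ((pi - \<alpha> * \<theta>) / 2))\<^sup>2)"
    if \<alpha>: "0 < \<alpha>" "\<alpha> < pi / \<theta>" and \<epsilon>: "0 < \<epsilon>" for \<alpha> \<epsilon>
  proof -
    define \<psi> where "\<psi> x = min 1 (u x / \<epsilon>)" for x
    have c\<psi>: "continuous_on S \<psi>" for S
      unfolding \<psi>_def by (intro continuous_intros cu) (use \<epsilon> in auto)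
    have \<psi>01: "0 \<le> \<psi> x" "\<psi> x \<le> 1" for x
      using \<epsilon> nonneg by (auto simp: \<psi>_def)
    have i\<psi>: "\<psi> integrable_on {c..d}" for c d
      by (intro integrable_continuous_real c\<psi>)
    \<comment> \<open>Splitting the slack \<open>pi - \<alpha> * \<theta>\<close> evenly keeps
      \<open>\<sigma>\<close> between \<open>\<delta>\<close> and \<open>pi - \<delta>\<close>,
      where \<open>sin\<close> is at least \<open>sin \<delta>\<close>.\<close>
    define \<delta> where "\<delta> = (pi - \<alpha> * \<theta>) / 2"
    have \<delta>: "0 < \<delta>" "\<alpha> * \<theta> + \<delta> = pi - \<delta>" "\<delta> < pi / 2"
      using \<alpha> \<theta> by (auto simp: \<delta>_def field_simps)
    define \<sigma> where "\<sigma> x = \<delta> + \<alpha> * integral {a..x} \<psi>" for x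
    \<comment> \<open>\<open>\<psi>\<close> lies below the indicator function of the set where
      \<open>u\<close> is positive.\<close>
    have total: "integral {a..b} \<psi> \<le> \<theta>"
    proof -
      let ?E = "{a..b} \<inter> {x. 0 < u x}"
      have "open {x. 0 < u x}"
        using open_Collect_less[of "\<lambda>x. 0" u] cu[of UNIV] by simp
      then have E: "?E \<in> lmeasurable"
        by (intro fmeasurable_Int_fmeasurable) (auto intro: borel_open sets_completionI_sets)
      have "measure lebesgue ?E = integral ?E (\<lambda>x. 1)"
        using lmeasure_integral[OF E] by simp
      also have "\<dots> = integral {a..b} (\<lambda>x. if 0 < u x then 1 else 0)"
        using integral_restrict_Int[of "{a..b}" "{x. 0 < u x}" "\<lambda>x. 1::real"]
        by (simp add: Int_commute)
      also have "\<dots> \<ge> integral {a..b} \<psi>"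
      proof (rule integral_le[OF i\<psi>])
        have "(\<lambda>x. 1::real) integrable_on ?E"
          using E by (simp add: lmeasurable_iff_integrable_on)
        then show "(\<lambda>x. if 0 < u x then 1::real else 0) integrable_on {a..b}"
          using integrable_restrict_Int[of "{x. 0 < u x}" "\<lambda>x. 1::real" "{a..b}"]
          by (simp add: Int_commute)
        show "\<psi> x \<le> (if 0 < u x then 1 else 0)" for x
          using \<psi>01 nonneg[of x] \<epsilon> by (auto simp: \<psi>_def)
      qed
      finally show ?thesis using \<theta> by simp
    qed
    have d\<sigma>: "(\<sigma> has_real_derivative \<alpha> * \<psi> x) (at x within {a..b})" if "x \<in> {a..b}" for x
      unfolding \<sigma>_def using integral_has_real_derivative[OF c\<psi> that]
      by (auto intro!: derivative_eq_intros)
    have \<sigma>_range: "\<delta> \<le> \<sigma> x" "\<sigma> x \<le> pi - \<delta>" if x: "x \<in> {a..b}" for x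
    proof -
      have "0 \<le> integral {a..x} \<psi>"
        by (intro integral_nonneg i\<psi> \<psi>01)
      moreover have "integral {a..x} \<psi> \<le> integral {a..b} \<psi>"
        using x by (intro integral_subset_le i\<psi>) (auto simp: \<psi>01)
      ultimately have "0 \<le> \<alpha> * integral {a..x} \<psi>" "\<alpha> * integral {a..x} \<psi> \<le> \<alpha> * \<theta>"
        using \<alpha> total by auto
      then show "\<delta> \<le> \<sigma> x" "\<sigma> x \<le> pi - \<delta>"
        using \<delta> unfolding \<sigma>_def by linarith+
    qed
    have sin_ge: "sin \<delta> \<le> sin (\<sigma> x)" if x: "x \<in> {a..b}" for x
    proof (cases "\<sigma> x \<le> pi / 2")
      case True
      then show ?thesis using \<delta> \<sigma>_range[OF x] by (intro sin_monotone_2pi_le) auto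
    next
      case False
      have "sin \<delta> \<le> sin (pi - \<sigma> x)"
        using False \<delta> \<sigma>_range[OF x] by (intro sin_monotone_2pi_le) auto
      then show ?thesis by simp
    qed
    have sin\<delta>: "0 < sin \<delta>" using \<delta> by (intro sin_gt_zero) auto
    \<comment> \<open>\<open>G\<close> vanishes at both ends because \<open>u\<close> does, so its
      derivative \<open>G'\<close> integrates to 0 and can be added to the integrand.\<close>
    define G where "G x = \<alpha> * (u x)\<^sup>2 * cot (\<sigma> x)" for x
    define G' where "G' x = 2 * \<alpha> * u x * u' x * cot (\<sigma> x)
      - \<alpha>\<^sup>2 * (u x)\<^sup>2 * \<psi> x * (1 + (cot (\<sigma> x))\<^sup>2)" for x
    have dG: "(G has_real_derivative G' x) (at x within {a..b})" if x: "x \<in> {a..b}" for x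
    proof -
      have s0: "sin (\<sigma> x) \<noteq> 0" using sin_ge[OF x] sin\<delta> by auto
      have e: "inverse ((sin (\<sigma> x))\<^sup>2) = 1 + (cot (\<sigma> x))\<^sup>2"
        using s0 sin_cos_squared_add[of "\<sigma> x"] by (simp add: cot_def field_simps)
      show ?thesis
        unfolding G_def G'_def e[symmetric]
        by (rule derivative_eq_intros DERIV_chain2[OF DERIV_cot] d\<sigma>[OF x]
             DERIV_subset[OF du] s0 refl subset_UNIV)+
          (simp add: algebra_simps power2_eq_square)
    qed
    have "(G' has_integral G b - G a) {a..b}"
      using dG ab by (intro fundamental_theorem_of_calculus)
        (auto simp: has_real_derivative_iff_has_vector_derivative)
    then have hG: "(G' has_integral 0) {a..b}" by (simp add: G_def ends)
    define K where "K = \<alpha>\<^sup>2 * \<epsilon>\<^sup>2 / (sin \<delta>)\<^sup>2"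
    \<comment> \<open>Here \<open>u'^2 - G' - \<alpha>^2 u^2\<close> is the square of
      \<open>u' - \<alpha> u cot \<sigma>\<close> minus
      \<open>\<alpha>^2 u^2 (1 - \<psi>) (1 + cot^2 \<sigma>)\<close>. The subtracted term is at
      most \<open>K\<close>, since \<open>1 - \<psi>\<close> vanishes for
      \<open>u \<ge> \<epsilon>\<close> and
      \<open>1 + cot^2 \<sigma> = 1 / sin^2 \<sigma>\<close>.\<close>
    have pt: "G' x + \<alpha>\<^sup>2 * (u x)\<^sup>2 \<le> (u' x)\<^sup>2 + K" if x: "x \<in> {a..b}" for x
    proof -
      have s0: "sin (\<sigma> x) \<noteq> 0" using sin_ge[OF x] sin\<delta> by auto
      have e: "1 + (cot (\<sigma> x))\<^sup>2 = 1 / ((sin (\<sigma> x))\<^sup>2)"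
        using s0 sin_cos_squared_add[of "\<sigma> x"] by (simp add: cot_def field_simps)
      have "(u x)\<^sup>2 * (1 - \<psi> x) \<le> \<epsilon>\<^sup>2"
      proof (cases "u x \<le> \<epsilon>")
        case True
        then have "(u x)\<^sup>2 * (1 - \<psi> x) \<le> \<epsilon>\<^sup>2 * 1"
          using \<psi>01[of x] nonneg[of x] by (intro mult_mono power_mono) auto
        then show ?thesis by simp
      next
        case False
        then show ?thesis using \<epsilon> by (simp add: \<psi>_def min_def field_simps)
      qed
      moreover have "1 / (sin (\<sigma> x))\<^sup>2 \<le> 1 / (sin \<delta>)\<^sup>2"
        using sin_ge[OF x] sin\<delta> by (intro divide_left_mono power_mono) auto
      ultimately have "((u x)\<^sup>2 * (1 - \<psi> x)) * (1 + (cot (\<sigma> x))\<^sup>2) \<le> \<epsilon>\<^sup>2 * (1 / (sin \<delta>)\<^sup>2)"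
        unfolding e using \<psi>01[of x] by (intro mult_mono) auto
      then have "\<alpha>\<^sup>2 * (((u x)\<^sup>2 * (1 - \<psi> x)) * (1 + (cot (\<sigma> x))\<^sup>2)) \<le> \<alpha>\<^sup>2 * (\<epsilon>\<^sup>2 * (1 / (sin \<delta>)\<^sup>2))"
        by (intro mult_left_mono) auto
      then have "\<alpha>\<^sup>2 * (((u x)\<^sup>2 * (1 - \<psi> x)) * (1 + (cot (\<sigma> x))\<^sup>2)) \<le> K"
        by (simp add: K_def)
      moreover have "0 \<le> (u' x - \<alpha> * u x * cot (\<sigma> x))\<^sup>2" by simp
      ultimately show ?thesis
        unfolding G'_def by (simp add: power2_eq_square algebra_simps)
    qed
    have "((\<lambda>x. G' x + \<alpha>\<^sup>2 * (u x)\<^sup>2) has_integral 0 + \<alpha>\<^sup>2 * I) {a..b}"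
      unfolding I_def using iu by (intro has_integral_add hG has_integral_mult_right) auto
    moreover have "((\<lambda>x. (u' x)\<^sup>2 + K) has_integral I' + (b - a) * K) {a..b}"
      unfolding I'_def using iu ab has_integral_const_real[of K a b]
      by (intro has_integral_add) auto
    ultimately have "0 + \<alpha>\<^sup>2 * I \<le> I' + (b - a) * K"
      using pt by (rule has_integral_le)
    then show ?thesis by (simp add: K_def \<delta>_def)
  qed
  have step2: "\<alpha>\<^sup>2 * I \<le> I'" if \<alpha>: "0 < \<alpha>" "\<alpha> < pi / \<theta>" for \<alpha>
  proof -
    have "((\<lambda>\<epsilon>. I' + (b - a) * (\<alpha>\<^sup>2 * \<epsilon>\<^sup>2 / (sin ((pi - \<alpha> * \<theta>) / 2))\<^sup>2)) \<longlongrightarrow>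
        I' + (b - a) * (\<alpha>\<^sup>2 * 0\<^sup>2 / (sin ((pi - \<alpha> * \<theta>) / 2))\<^sup>2)) (at_right 0)"
      unfolding divide_inverse by (intro tendsto_intros)
    moreover have "eventually (\<lambda>\<epsilon>. \<alpha>\<^sup>2 * I \<le>
        I' + (b - a) * (\<alpha>\<^sup>2 * \<epsilon>\<^sup>2 / (sin ((pi - \<alpha> * \<theta>) / 2))\<^sup>2)) (at_right 0)"
      using step[OF \<alpha>] by (auto simp: eventually_at_right_field intro: exI[of _ 1])
    ultimately show ?thesis
      using tendsto_lowerbound[of _ _ "at_right (0::real)" "\<alpha>\<^sup>2 * I"] by simp
  qed
  have "((\<lambda>\<alpha>. \<alpha>\<^sup>2 * I) \<longlongrightarrow> (pi / \<theta>)\<^sup>2 * I) (at_left (pi / \<theta>))"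
    by (intro tendsto_intros)
  moreover have "eventually (\<lambda>\<alpha>. \<alpha>\<^sup>2 * I \<le> I') (at_left (pi / \<theta>))"
    using eventually_at_left_real[of 0 "pi / \<theta>"] \<theta> step2
    by (auto elim: eventually_mono)
  ultimately show ?thesis
    using tendsto_upperbound[of _ _ "at_left (pi / \<theta>)" I'] by (simp add: I_def I'_def)
qed

text \<open>Lets a full-period integral start anywhere, in particular at a zero of \<open>u\<close>.
  For \<open>c\<close> in \<open>[0, p]\<close> the piece beyond \<open>p\<close> is translated back
  to \<open>[0, c]\<close>; every other \<open>c\<close> is reduced to this case by an integer
  multiple of \<open>p\<close>.\<close>

lemma periodic_integral_shift:
  fixes h :: "real \<Rightarrow> real"
  assumes cont: "continuous_on UNIV h" and per: "\<And>x. h (x + p) = h x" and "0 < p"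
  shows "integral {c..c + p} h = integral {0..p} h"
proof -
  have *: "integral {c..c + p} h = integral {0..p} h" if c: "0 \<le> c" "c \<le> p" for c
  proof -
    have i: "h integrable_on {x..y}" for x y
      by (intro integrable_continuous_real continuous_on_subset[OF cont]) auto
    have "integral {p..c + p} h = integral {0..c} h"
      using integral_shift_Icc_real[of 0 c h p] by (simp add: o_def per add.commute)
    moreover have "integral {c..p} h + integral {p..c + p} h = integral {c..c + p} h"
      using c by (intro Henstock_Kurzweil_Integration.integral_combine i) auto
    moreover have "integral {0..c} h + integral {c..p} h = integral {0..p} h"
      using c by (intro Henstock_Kurzweil_Integration.integral_combine i) auto
    ultimately show ?thesis by simp
  qed
  define n where "n = \<lfloor>c / p\<rfloor>"
  have perk: "h (of_int k * p + x) = h x" for x k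
  proof (induction k rule: int_induct[where k=0])
    case (step1 i)
    have "h (of_int i * p + x + p) = h (of_int i * p + x)" by (rule per)
    with step1 show ?case by (simp add: algebra_simps)
  next
    case (step2 i)
    have "h (of_int (i - 1) * p + x + p) = h (of_int (i - 1) * p + x)" by (rule per)
    with step2 show ?case by (simp add: algebra_simps)
  qed simp
  define c' where "c' = c - n * p"
  have "0 \<le> c'" "c' \<le> p"
    using floor_divide_lower[OF \<open>0 < p\<close>, of c] floor_divide_upper[OF \<open>0 < p\<close>, of c]
    by (auto simp: c'_def n_def algebra_simps)
  then have "integral {c'..c' + p} h = integral {0..p} h" by (rule *)
  moreover have "integral {c..c + p} h = integral {c'..c' + p} h"
    using integral_shift_Icc_real[of c' "c' + p" h "n * p"]
    by (simp add: c'_def o_def perk)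
  ultimately show ?thesis by simp
qed

subsection \<open>Circular means of periodic subharmonic functions\<close>

text \<open>Subharmonic functions in the logarithmic polar coordinates \<open>exp (t + \<i>s)\<close>; the
  subscripts \<open>t\<close>, \<open>s\<close> are partial derivatives.\<close>

locale periodic_subharmonic =
  fixes u ut us utt uss :: "real \<Rightarrow> real \<Rightarrow> real"
  assumes du_t: "\<And>t s. ((\<lambda>t. u t s) has_real_derivative ut t s) (at t)"
    and dut_t: "\<And>t s. ((\<lambda>t. ut t s) has_real_derivative utt t s) (at t)"
    and du_s: "\<And>t s. ((\<lambda>s. u t s) has_real_derivative us t s) (at s)"
    and dus_s: "\<And>t s. ((\<lambda>s. us t s) has_real_derivative uss t s) (at s)"
    and cont: "continuous_on UNIV (case_prod u)" "continuous_on UNIV (case_prod ut)"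
      "continuous_on UNIV (case_prod us)" "continuous_on UNIV (case_prod utt)"
      "continuous_on UNIV (case_prod uss)"
    and subharmonic: "\<And>t s. 0 \<le> utt t s + uss t s"
    and nonneg: "\<And>t s. 0 \<le> u t s"
    and per: "\<And>t s. u t (s + 2 * pi) = u t s" "\<And>t s. us t (s + 2 * pi) = us t s"
begin

lemma cont_compose:
  assumes "continuous_on S p" "continuous_on S q"
  shows "continuous_on S (\<lambda>x. u (p x) (q x))" "continuous_on S (\<lambda>x. ut (p x) (q x))"
    "continuous_on S (\<lambda>x. us (p x) (q x))" "continuous_on S (\<lambda>x. utt (p x) (q x))"
    "continuous_on S (\<lambda>x. uss (p x) (q x))"
  using cont[THEN continuous_on_compose2, of S "\<lambda>x. (p x, q x)"] assms
  by (simp_all add: continuous_on_Pair)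

definition mass where "mass t = integral {0..2 * pi} (\<lambda>s. (u t s)\<^sup>2)"
definition mass' where "mass' t = integral {0..2 * pi} (\<lambda>s. 2 * u t s * ut t s)"
definition mass'' where
  "mass'' t = integral {0..2 * pi} (\<lambda>s. 2 * ((ut t s)\<^sup>2 + u t s * utt t s))"

lemma DERIV_mass: "(mass has_real_derivative mass' t) (at t)"
proof -
  have "((\<lambda>t. integral (cbox 0 (2 * pi)) (\<lambda>s. (u t s)\<^sup>2)) has_real_derivative
      integral (cbox 0 (2 * pi)) (\<lambda>s. 2 * u t s * ut t s)) (at t within UNIV)"
  proof (rule leibniz_rule_field_derivative)
    show "((\<lambda>t. (u t s)\<^sup>2) has_real_derivative 2 * u t s * ut t s) (at t within UNIV)" for t s
      using du_t[of s t] by (auto intro!: derivative_eq_intros)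
    show "(\<lambda>s. (u t s)\<^sup>2) integrable_on cbox 0 (2 * pi)" for t
      by (intro integrable_continuous continuous_intros cont_compose)
    show "continuous_on (UNIV \<times> cbox 0 (2 * pi)) (\<lambda>(t, s). 2 * u t s * ut t s)"
      unfolding case_prod_beta by (intro continuous_intros cont_compose)
  qed auto
  then show ?thesis by (simp add: mass_def[abs_def] mass'_def)
qed

lemma DERIV_mass': "(mass' has_real_derivative mass'' t) (at t)"
proof -
  have "((\<lambda>t. integral (cbox 0 (2 * pi)) (\<lambda>s. 2 * u t s * ut t s)) has_real_derivative
      integral (cbox 0 (2 * pi)) (\<lambda>s. 2 * ((ut t s)\<^sup>2 + u t s * utt t s))) (at t within UNIV)"
  proof (rule leibniz_rule_field_derivative)
    show "((\<lambda>t. 2 * u t s * ut t s) has_real_derivative 2 * ((ut t s)\<^sup>2 + u t s * utt t s))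
        (at t within UNIV)" for t s
      using du_t[of s t] dut_t[of s t]
      by (auto intro!: derivative_eq_intros simp: power2_eq_square algebra_simps)
    show "(\<lambda>s. 2 * u t s * ut t s) integrable_on cbox 0 (2 * pi)" for t
      by (intro integrable_continuous continuous_intros cont_compose)
    show "continuous_on (UNIV \<times> cbox 0 (2 * pi)) (\<lambda>(t, s). 2 * ((ut t s)\<^sup>2 + u t s * utt t s))"
      unfolding case_prod_beta by (intro continuous_intros cont_compose)
  qed auto
  then show ?thesis by (simp add: mass'_def[abs_def] mass''_def)
qed

text \<open>Integration by parts in \<open>s\<close>, with boundary terms cancelling by periodicity,
  makes the integral of \<open>u uss\<close> minus that of \<open>us^2\<close>. Subharmonicity and
  \<open>u \<ge> 0\<close> give \<open>u utt \<ge> - u uss\<close>.\<close>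

lemma mass''_ge:
  "2 * integral {0..2 * pi} (\<lambda>s. (ut t s)\<^sup>2) + 2 * integral {0..2 * pi} (\<lambda>s. (us t s)\<^sup>2) \<le> mass'' t"
proof -
  have int: "(\<lambda>s. (ut t s)\<^sup>2) integrable_on {0..2*pi}" "(\<lambda>s. (us t s)\<^sup>2) integrable_on {0..2*pi}"
    "(\<lambda>s. 2 * ((ut t s)\<^sup>2 + u t s * utt t s)) integrable_on {0..2*pi}"
    by (intro integrable_continuous_real continuous_intros cont_compose)+
  have "((\<lambda>s. (us t s)\<^sup>2 + u t s * uss t s) has_integral
      u t (2 * pi) * us t (2 * pi) - u t 0 * us t 0) {0..2 * pi}"
  proof (rule fundamental_theorem_of_calculus)
    fix s
    have "((\<lambda>s. u t s * us t s) has_real_derivative (us t s)\<^sup>2 + u t s * uss t s) (at s)"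
      using du_s[of t s] dus_s[of t s]
      by (auto intro!: derivative_eq_intros simp: power2_eq_square algebra_simps)
    then show "((\<lambda>s. u t s * us t s) has_vector_derivative (us t s)\<^sup>2 + u t s * uss t s)
        (at s within {0..2 * pi})"
      by (metis has_real_derivative_iff_has_vector_derivative has_vector_derivative_at_within)
  qed auto
  then have parts: "((\<lambda>s. (us t s)\<^sup>2 + u t s * uss t s) has_integral 0) {0..2 * pi}"
    using per[of t 0] by simp
  have "((\<lambda>s. 2 * ((ut t s)\<^sup>2 + (us t s)\<^sup>2 - ((us t s)\<^sup>2 + u t s * uss t s))) has_integral
      2 * (integral {0..2 * pi} (\<lambda>s. (ut t s)\<^sup>2) + integral {0..2 * pi} (\<lambda>s. (us t s)\<^sup>2) - 0)) {0..2*pi}"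
    by (intro has_integral_mult_right has_integral_diff has_integral_add parts
        integrable_integral int)
  moreover have "((\<lambda>s. 2 * ((ut t s)\<^sup>2 + u t s * utt t s)) has_integral mass'' t) {0..2 * pi}"
    unfolding mass''_def by (intro integrable_integral int)
  ultimately have "2 * (integral {0..2 * pi} (\<lambda>s. (ut t s)\<^sup>2) + integral {0..2 * pi} (\<lambda>s. (us t s)\<^sup>2) - 0)
      \<le> mass'' t"
  proof (rule has_integral_le)
    fix s
    have "0 \<le> u t s * (utt t s + uss t s)"
      by (intro mult_nonneg_nonneg nonneg subharmonic)
    then show "2 * ((ut t s)\<^sup>2 + (us t s)\<^sup>2 - ((us t s)\<^sup>2 + u t s * uss t s))
        \<le> 2 * ((ut t s)\<^sup>2 + u t s * utt t s)"
      by (simp add: algebra_simps)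
  qed
  then show ?thesis by simp
qed

lemma mass''_nonneg: "0 \<le> mass'' t"
proof -
  have "0 \<le> integral {0..2 * pi} (\<lambda>s. (ut t s)\<^sup>2)" "0 \<le> integral {0..2 * pi} (\<lambda>s. (us t s)\<^sup>2)"
    by (intro integral_nonneg integrable_continuous_real continuous_intros cont_compose; simp)+
  then show ?thesis using mass''_ge[of t] by linarith
qed

lemma mass'_mono: "t \<le> t' \<Longrightarrow> mass' t \<le> mass' t'"
  using DERIV_mass' mass''_nonneg by (meson DERIV_nonneg_imp_nondecreasing)

lemma mass_nonneg: "0 \<le> mass t"
  unfolding mass_def
  by (intro integral_nonneg integrable_continuous_real continuous_intros cont_compose; simp)

text \<open>Since \<open>mass'\<close> is nondecreasing and \<open>mass t \<ge> 0\<close>, the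
  increase of \<open>mass\<close> over \<open>[t, t + 1]\<close> dominates \<open>mass' t\<close>.
  This converts lower bounds on \<open>mass'\<close> into lower bounds on
  \<open>mass\<close>.\<close>

lemma mass'_le: "mass' t \<le> mass (t + 1)"
proof -
  obtain \<xi> where "t < \<xi>" "mass (t + 1) - mass t = (t + 1 - t) * mass' \<xi>"
    using MVT2[of t "t + 1" mass mass'] DERIV_mass by auto
  then show ?thesis using mass'_mono[of t \<xi>] mass_nonneg[of t] by simp
qed

lemma mass_le:
  assumes "\<And>s. u t s \<le> M"
  shows "mass t \<le> 2 * pi * M\<^sup>2"
proof -
  have "integral {0..2 * pi} (\<lambda>s. (u t s)\<^sup>2) \<le> integral {0..2 * pi} (\<lambda>s. M\<^sup>2)"
    by (intro integral_le integrable_continuous_real continuous_intros cont_compose power_mono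
        assms nonneg)
  then show ?thesis by (simp add: mass_def)
qed

lemma mass_pos:
  assumes "0 < u t s" "s \<in> {0..2 * pi}"
  shows "0 < mass t"
proof (rule ccontr)
  assume "\<not> 0 < mass t"
  then have "integral {0..2 * pi} (\<lambda>s. (u t s)\<^sup>2) = 0"
    using mass_nonneg[of t] by (simp add: mass_def)
  moreover have "continuous_on {0..2 * pi} (\<lambda>s. (u t s)\<^sup>2)"
    by (intro continuous_intros cont_compose)
  ultimately have "\<forall>s\<in>{0..2 * pi}. (u t s)\<^sup>2 = 0"
    by (subst (asm) integral_eq_0_iff) auto
  then show False using assms by auto
qed

lemma mass'_pos_imp_pos:
  assumes "0 < mass' t"
  obtains s where "0 < u t s"
proof -
  have "mass' t = 0" if "\<And>s. u t s = 0"
    using that by (simp add: mass'_def)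
  then show ?thesis using assms that nonneg[of t] by (metis less_irrefl order_le_less)
qed

text \<open>The window is half-open so that, when \<open>u t c = 0\<close>, a point of positivity
  moved into it lies in the open interval.\<close>

lemma shift_into_period:
  fixes s c :: real
  obtains r where "r \<in> {c..<c + 2 * pi}" "u t r = u t s"
proof -
  have perk: "u t (x + of_int k * (2 * pi)) = u t x" for x k
  proof (induction k rule: int_induct[where k=0])
    case (step1 i)
    then show ?case using per(1)[of t "x + of_int i * (2 * pi)"] by (simp add: algebra_simps)
  next
    case (step2 i)
    then show ?case using per(1)[of t "x + of_int (i - 1) * (2 * pi)"] by (simp add: algebra_simps)
  qed simp
  define n where "n = \<lfloor>(s - c) / (2 * pi)\<rfloor>"
  show thesis
  proof
    show "s - n * (2 * pi) \<in> {c..<c + 2 * pi}"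
      using floor_divide_lower[of "2 * pi" "s - c"] floor_divide_upper[of "2 * pi" "s - c"]
      by (auto simp: n_def algebra_simps)
    show "u t (s - n * (2 * pi)) = u t s"
      using perk[of "s - n * (2 * pi)" n] by simp
  qed
qed

text \<open>Uses \<open>2 \<alpha> u u\<^sub>t \<le> u\<^sub>t\<^sup>2 + \<alpha>\<^sup>2 u\<^sup>2\<close> with \<open>\<alpha> = pi / \<theta>\<close>.\<close>

lemma mass''_ge_mass':
  assumes zero: "u t c = 0" and \<theta>: "0 < \<theta>"
    "measure lebesgue ({c..c + 2 * pi} \<inter> {s. 0 < u t s}) \<le> \<theta>"
  shows "2 * pi / \<theta> * mass' t \<le> mass'' t"
proof -
  define \<alpha> where "\<alpha> = pi / \<theta>"
  have \<alpha>: "0 < \<alpha>" using \<theta> by (simp add: \<alpha>_def)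
  have "\<alpha>\<^sup>2 * integral {c..c + 2 * pi} (\<lambda>s. (u t s)\<^sup>2) \<le> integral {c..c + 2 * pi} (\<lambda>s. (us t s)\<^sup>2)"
    unfolding \<alpha>_def using zero per(1)[of t c]
    by (intro wirtinger_support du_s nonneg \<theta> cont_compose continuous_intros) auto
  moreover have "integral {c..c + 2 * pi} (\<lambda>s. (u t s)\<^sup>2) = integral {0..2 * pi} (\<lambda>s. (u t s)\<^sup>2)"
    by (intro periodic_integral_shift continuous_intros cont_compose) (simp_all add: per)
  moreover have "integral {c..c + 2 * pi} (\<lambda>s. (us t s)\<^sup>2) = integral {0..2 * pi} (\<lambda>s. (us t s)\<^sup>2)"
    by (intro periodic_integral_shift continuous_intros cont_compose) (simp_all add: per)
  ultimately have W: "\<alpha>\<^sup>2 * integral {0..2 * pi} (\<lambda>s. (u t s)\<^sup>2) \<le> integral {0..2 * pi} (\<lambda>s. (us t s)\<^sup>2)"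
    by simp
  have int: "(\<lambda>s. (ut t s)\<^sup>2) integrable_on {0..2*pi}" "(\<lambda>s. (u t s)\<^sup>2) integrable_on {0..2*pi}"
    "(\<lambda>s. 2 * u t s * ut t s) integrable_on {0..2*pi}"
    by (intro integrable_continuous_real continuous_intros cont_compose)+
  have "((\<lambda>s. \<alpha> * (2 * u t s * ut t s)) has_integral \<alpha> * mass' t) {0..2 * pi}"
    unfolding mass'_def by (intro has_integral_mult_right integrable_integral int)
  moreover have "((\<lambda>s. (ut t s)\<^sup>2 + \<alpha>\<^sup>2 * (u t s)\<^sup>2) has_integral
     integral {0..2 * pi} (\<lambda>s. (ut t s)\<^sup>2) + \<alpha>\<^sup>2 * integral {0..2 * pi} (\<lambda>s. (u t s)\<^sup>2)) {0..2 * pi}"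
    by (intro has_integral_add has_integral_mult_right integrable_integral int)
  ultimately have "\<alpha> * mass' t
      \<le> integral {0..2 * pi} (\<lambda>s. (ut t s)\<^sup>2) + \<alpha>\<^sup>2 * integral {0..2 * pi} (\<lambda>s. (u t s)\<^sup>2)"
  proof (rule has_integral_le)
    fix s
    have "0 \<le> (ut t s - \<alpha> * u t s)\<^sup>2" by simp
    then show "\<alpha> * (2 * u t s * ut t s) \<le> (ut t s)\<^sup>2 + \<alpha>\<^sup>2 * (u t s)\<^sup>2"
      by (simp add: power2_eq_square algebra_simps)
  qed
  with W mass''_ge[of t] have "2 * (\<alpha> * mass' t) \<le> mass'' t" by linarith
  then show ?thesis by (simp add: \<alpha>_def)
qed

text \<open>The positivity set is open and, by periodicity, meets the open interval, so it is not
  negligible. This supplies the positive \<open>\<theta>\<close> that \<open>mass''_ge_mass'\<close>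
  divides by.\<close>

lemma support_measure_pos:
  assumes "0 < u t s" "u t c = 0"
  shows "0 < measure lebesgue ({c..c + 2 * pi} \<inter> {s. 0 < u t s})"
proof -
  have o: "open {s. 0 < u t s}"
    using open_Collect_less[of "\<lambda>x. 0" "u t"] cont_compose(1)[of UNIV "\<lambda>_. t" "\<lambda>x. x"] by simp
  obtain r where r: "r \<in> {c..<c + 2 * pi}" "u t r = u t s"
    by (rule shift_into_period)
  have "r \<noteq> c" using assms r by auto
  then have "r \<in> {c<..<c + 2 * pi} \<inter> {s. 0 < u t s}" using r assms by auto
  then have "\<not> negligible ({c<..<c + 2 * pi} \<inter> {s. 0 < u t s})"
    using o by (intro open_not_negligible) auto
  then have "\<not> negligible ({c..c + 2 * pi} \<inter> {s. 0 < u t s})"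
    using negligible_subset by (metis (no_types, lifting) Int_mono greaterThanLessThan_subseteq_atLeastAtMost_iff order_refl)
  moreover have "{c..c + 2 * pi} \<inter> {s. 0 < u t s} \<in> lmeasurable"
    using o by (intro fmeasurable_Int_fmeasurable) (auto intro: borel_open sets_completionI_sets)
  ultimately show ?thesis
    by (metis measure_nonneg negligible_iff_measure order_le_less)
qed

end

section \<open>Two phases with disjoint supports\<close>

text \<open>Otherwise the two positivity sets would disconnect the real line. The circle is cut open
  at the common zero, so that both functions vanish at the ends, as \<open>wirtinger_support\<close>
  requires.\<close>

lemma disjoint_phases_common_zero:
  fixes p q :: "real \<Rightarrow> real"
  assumes cont: "continuous_on UNIV p" "continuous_on UNIV q"
    and nonneg: "\<And>x. 0 \<le> p x" "\<And>x. 0 \<le> q x" and disj: "\<And>x. p x * q x = 0"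
    and pos: "0 < p a" "0 < q b"
  obtains c where "p c = 0" "q c = 0"
proof (rule ccontr)
  assume "\<not> thesis"
  then have "UNIV \<subseteq> {x. 0 < p x} \<union> {x. 0 < q x}"
    using that nonneg by (force simp: order_le_less)
  moreover have "open {x. 0 < p x}" "open {x. 0 < q x}"
    using cont by (auto intro!: open_Collect_less)
  moreover have "{x. 0 < p x} \<inter> {x. 0 < q x} \<inter> UNIV = {}"
    using disj by (auto simp: order_less_le)
  ultimately show False
    using pos connected_UNIV[where 'a=real] unfolding connected_def by blast
qed

text \<open>With \<open>x\<close>, \<open>y\<close> the measures of the two supports in one period,
  \<open>mass''\<close> is at least \<open>2 * pi / x\<close> or \<open>2 * pi / y\<close> times
  \<open>mass'\<close>. Disjointness gives \<open>x + y \<le> 2 * pi\<close>, and then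
  \<open>(x - y)^2 \<ge> 0\<close> bounds the sum of the two rates below by 4.\<close>

lemma two_phase_growth:
  assumes "periodic_subharmonic u ut us utt uss" "periodic_subharmonic v vt vs vtt vss"
    and disj: "\<And>t s. u t s * v t s = 0"
    and pos: "0 < periodic_subharmonic.mass' u ut t" "0 < periodic_subharmonic.mass' v vt t"
  shows "4 * periodic_subharmonic.mass' u ut t * periodic_subharmonic.mass' v vt t
    \<le> periodic_subharmonic.mass'' u ut utt t * periodic_subharmonic.mass' v vt t
      + periodic_subharmonic.mass' u ut t * periodic_subharmonic.mass'' v vt vtt t"
proof -
  interpret U: periodic_subharmonic u ut us utt uss by fact
  interpret V: periodic_subharmonic v vt vs vtt vss by fact
  obtain a where a: "0 < u t a" using U.mass'_pos_imp_pos pos by blast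
  obtain b where b: "0 < v t b" using V.mass'_pos_imp_pos pos by blast
  have cont: "continuous_on UNIV (u t)" "continuous_on UNIV (v t)"
    using U.cont_compose(1)[of UNIV "\<lambda>_. t" "\<lambda>x. x"] V.cont_compose(1)[of UNIV "\<lambda>_. t" "\<lambda>x. x"]
    by auto
  obtain c where c: "u t c = 0" "v t c = 0"
    using disjoint_phases_common_zero[OF cont U.nonneg V.nonneg disj a b] by blast
  define A where "A = {c..c + 2 * pi} \<inter> {s. 0 < u t s}"
  define B where "B = {c..c + 2 * pi} \<inter> {s. 0 < v t s}"
  have "open {s. 0 < u t s}" "open {s. 0 < v t s}"
    using cont by (auto intro!: open_Collect_less)
  then have meas: "A \<in> lmeasurable" "B \<in> lmeasurable" unfolding A_def B_def
    by (auto intro!: fmeasurable_Int_fmeasurable intro: borel_open sets_completionI_sets)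
  have "A \<inter> B = {}" using disj[of t] by (auto simp: A_def B_def order_less_le)
  then have "measure lebesgue A + measure lebesgue B = measure lebesgue (A \<union> B)"
    using meas by (simp add: measure_Un3)
  also have "\<dots> \<le> measure lebesgue {c..c + 2 * pi}"
    using meas by (intro measure_mono_fmeasurable) (auto simp: A_def B_def)
  finally have sum: "measure lebesgue A + measure lebesgue B \<le> 2 * pi" by simp
  define x where "x = measure lebesgue A"
  define y where "y = measure lebesgue B"
  have xy: "0 < x" "0 < y" "x + y \<le> 2 * pi"
    using sum U.support_measure_pos[OF a c(1)] V.support_measure_pos[OF b c(2)]
    by (auto simp: x_def y_def A_def B_def)
  have "4 \<le> 2 * pi / x + 2 * pi / y"
  proof -
    have "4 * (x * y) \<le> (x + y) * (x + y)"
      using sum_squares_ge_zero[of "x - y" 0] by (simp add: algebra_simps)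
    also have "\<dots> \<le> 2 * pi * (x + y)" using xy by (intro mult_right_mono) auto
    finally show ?thesis using xy by (simp add: field_simps)
  qed
  then have "4 * (U.mass' t * V.mass' t) \<le> (2 * pi / x + 2 * pi / y) * (U.mass' t * V.mass' t)"
    using pos by (intro mult_right_mono) auto
  also have "\<dots> = (2 * pi / x * U.mass' t) * V.mass' t + U.mass' t * (2 * pi / y * V.mass' t)"
    by (simp add: algebra_simps)
  also have "\<dots> \<le> U.mass'' t * V.mass' t + U.mass' t * V.mass'' t"
    using pos xy c
    by (intro add_mono mult_right_mono mult_left_mono U.mass''_ge_mass' V.mass''_ge_mass')
      (auto simp: x_def y_def A_def B_def)
  finally show ?thesis by (simp add: mult.assoc)
qed

text \<open>By \<open>two_phase_growth\<close> the product of both \<open>mass'\<close> with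
  \<open>exp (- 4 * t)\<close> is nondecreasing from \<open>t0\<close> on; its value at
  \<open>t0\<close> serves as \<open>q\<close>.\<close>

lemma two_phase_lower_bound:
  assumes "periodic_subharmonic u ut us utt uss" "periodic_subharmonic v vt vs vtt vss"
    and disj: "\<And>t s. u t s * v t s = 0"
    and pos: "0 < periodic_subharmonic.mass' u ut t0" "0 < periodic_subharmonic.mass' v vt t0"
  obtains q where "0 < q" and "\<And>t. t0 \<le> t \<Longrightarrow>
    q * exp (4 * t) \<le> periodic_subharmonic.mass u (t + 1) * periodic_subharmonic.mass v (t + 1)"
proof -
  interpret U: periodic_subharmonic u ut us utt uss by fact
  interpret V: periodic_subharmonic v vt vs vtt vss by fact
  define Q where "Q t = U.mass' t * V.mass' t * exp (- 4 * t)" for t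
  have post: "0 < U.mass' t" "0 < V.mass' t" if "t0 \<le> t" for t
    using that pos U.mass'_mono[of t0 t] V.mass'_mono[of t0 t] by auto
  have Qmono: "Q t0 \<le> Q t" if "t0 \<le> t" for t
  proof (rule DERIV_nonneg_imp_nondecreasing[OF that])
    fix x assume x: "t0 \<le> x" "x \<le> t"
    let ?D = "(U.mass'' x * V.mass' x + U.mass' x * V.mass'' x
      - 4 * U.mass' x * V.mass' x) * exp (- 4 * x)"
    have "(Q has_real_derivative ?D) (at x)"
      unfolding Q_def[abs_def]
      by (rule derivative_eq_intros U.DERIV_mass' V.DERIV_mass' refl)+ (simp add: algebra_simps)
    moreover have "0 \<le> ?D"
      using two_phase_growth[OF assms(1,2) disj] post[OF x(1)] by simp
    ultimately show "\<exists>y. (Q has_real_derivative y) (at x) \<and> 0 \<le> y" by blast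
  qed
  show thesis
  proof
    show "0 < Q t0" using pos by (simp add: Q_def)
    fix t assume t: "t0 \<le> t"
    have "Q t0 * exp (4 * t) \<le> Q t * exp (4 * t)"
      using Qmono[OF t] by (intro mult_right_mono) auto
    also have "\<dots> = U.mass' t * V.mass' t"
      by (simp add: Q_def mult.assoc flip: exp_add)
    also have "\<dots> \<le> U.mass (t + 1) * V.mass (t + 1)"
      using post[OF t] U.mass_nonneg by (intro mult_mono U.mass'_le V.mass'_le) auto
    finally show "Q t0 * exp (4 * t) \<le> U.mass (t + 1) * V.mass (t + 1)" .
  qed
qed

subsection \<open>Smoothed logarithms of holomorphic functions\<close>

text \<open>Because \<open>G\<close> and \<open>G'\<close> vanish at \<open>a\<close>, extending by
  0 to the left keeps differentiability. With \<open>a = 1\<close> this handles the kink of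
  \<open>max 1 y\<close>.\<close>

lemma DERIV_glue_zero:
  fixes G G' :: "real \<Rightarrow> real"
  assumes d: "\<And>y. a \<le> y \<Longrightarrow> (G has_real_derivative G' y) (at y)"
    and z: "G a = 0" "G' a = 0"
  shows "((\<lambda>y. G (max a y)) has_real_derivative G' (max a y)) (at y)"
proof -
  have "((\<lambda>y. if y \<in> {a..} then G y else 0) has_vector_derivative
      (if y \<in> {a..} then G' y else 0)) (at y within UNIV)"
  proof (rule has_vector_derivative_If_within_closures[where T = "{..a}"])
    show "(G has_vector_derivative G' y) (at y within {a..} \<union> (closure {a..} \<inter> closure {..a}))"
      if "y \<in> {a..} \<union> (closure {a..} \<inter> closure {..a})"
      using that d[of y]
      by (auto simp: has_real_derivative_iff_has_vector_derivative
          intro: has_vector_derivative_at_within)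
  qed (use z in auto)
  moreover have "(\<lambda>y. if y \<in> {a..} then G y else 0) = (\<lambda>y. G (max a y))"
    using z by (auto simp: max_def)
  moreover have "(if y \<in> {a..} then G' y else 0) = G' (max a y)"
    using z by (auto simp: max_def)
  ultimately show ?thesis
    by (simp add: has_real_derivative_iff_has_vector_derivative)
qed

text \<open>A \<open>C\<^sup>2\<close> substitute for \<open>log\<^sup>+ y\<close>: with \<open>\<psi> x = x\<^sup>3 / (1 + x)\<^sup>2\<close>, which is convex for
  \<open>x \<ge> 0\<close> and vanishes to third order at \<open>0\<close>, it is \<open>\<psi> (log\<^sup>+ y)\<close>. Convexity of \<open>\<psi>\<close> makes its
  composition with \<open>\<bar>F\<bar>\<^sup>2\<close> subharmonic for holomorphic \<open>F\<close>.\<close>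

definition slog :: "real \<Rightarrow> real" where
  "slog y = (ln (max 1 y)) ^ 3 / (1 + ln (max 1 y))\<^sup>2"

definition slog' :: "real \<Rightarrow> real" where
  "slog' y = (ln (max 1 y))\<^sup>2 * (ln (max 1 y) + 3) / (1 + ln (max 1 y)) ^ 3 / max 1 y"

definition slog'' :: "real \<Rightarrow> real" where
  "slog'' y = (6 * ln (max 1 y) / (1 + ln (max 1 y)) ^ 4
     - (ln (max 1 y))\<^sup>2 * (ln (max 1 y) + 3) / (1 + ln (max 1 y)) ^ 3) / (max 1 y)\<^sup>2"

lemma DERIV_slog: "(slog has_real_derivative slog' y) (at y)"
proof -
  have "((\<lambda>y. (\<lambda>y. ln y ^ 3 / (1 + ln y)\<^sup>2) (max 1 y)) has_real_derivative
      (\<lambda>y. (ln y)\<^sup>2 * (ln y + 3) / (1 + ln y) ^ 3 / y) (max 1 y)) (at y)"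
  proof (rule DERIV_glue_zero)
    fix y :: real assume y: "1 \<le> y"
    then have p: "0 < 1 + ln y" using ln_ge_zero[of y] by linarith
    \<comment> \<open>The left side is the output of the quotient rule, with \<open>l\<close> in
      place of \<open>ln y\<close>.\<close>
    have e: "(3 * l\<^sup>2 * (1 / y) * (1 + l)\<^sup>2 - l ^ 3 * (2 * (1 + l) * (1 / y))) / ((1 + l)\<^sup>2 * (1 + l)\<^sup>2)
        = l\<^sup>2 * (l + 3) / (1 + l) ^ 3 / y" if "0 < 1 + l" for l
    proof -
      have "(3 * l\<^sup>2 * (1 / y) * (1 + l)\<^sup>2 - l ^ 3 * (2 * (1 + l) * (1 / y)))
          = (l\<^sup>2 * (l + 3)) * (1 + l) / y"
        using y by (simp add: field_simps power2_eq_square power3_eq_cube)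
      moreover have "(1 + l)\<^sup>2 * (1 + l)\<^sup>2 = (1 + l) ^ 3 * (1 + l)"
        by (simp add: power2_eq_square power3_eq_cube)
      ultimately show ?thesis using that by simp
    qed
    show "((\<lambda>y. ln y ^ 3 / (1 + ln y)\<^sup>2) has_real_derivative
        (ln y)\<^sup>2 * (ln y + 3) / (1 + ln y) ^ 3 / y) (at y)"
      unfolding e[OF p, symmetric] using y p
      by (auto intro!: derivative_eq_intros simp: power2_eq_square)
  qed auto
  then show ?thesis by (simp add: slog_def[abs_def] slog'_def)
qed

lemma DERIV_slog': "(slog' has_real_derivative slog'' y) (at y)"
proof -
  have "((\<lambda>y. (\<lambda>y. (ln y)\<^sup>2 * (ln y + 3) / (1 + ln y) ^ 3 / y) (max 1 y)) has_real_derivative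
      (\<lambda>y. (6 * ln y / (1 + ln y) ^ 4 - (ln y)\<^sup>2 * (ln y + 3) / (1 + ln y) ^ 3) / y\<^sup>2) (max 1 y)) (at y)"
  proof (rule DERIV_glue_zero)
    fix y :: real assume y: "1 \<le> y"
    then have p: "0 < 1 + ln y" using ln_ge_zero[of y] by linarith
    have e: "((2 * l * (1 / y) * (l + 3) + l\<^sup>2 * (1 / y)) * (1 + l) ^ 3
          - l\<^sup>2 * (l + 3) * (3 * (1 + l)\<^sup>2 * (1 / y))) / ((1 + l) ^ 3 * (1 + l) ^ 3)
        = 6 * l / (1 + l) ^ 4 / y" if "0 < 1 + l" for l
    proof -
      have "((2 * l * (1 / y) * (l + 3) + l\<^sup>2 * (1 / y)) * (1 + l) ^ 3
          - l\<^sup>2 * (l + 3) * (3 * (1 + l)\<^sup>2 * (1 / y))) = 6 * l / y * (1 + l)\<^sup>2"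
        using y by (simp add: field_simps power2_eq_square power3_eq_cube)
      moreover have "(1 + l) ^ 3 * (1 + l) ^ 3 = (1 + l) ^ 4 * (1 + l)\<^sup>2"
        by (simp flip: power_add)
      moreover have "6 * l / y * (1 + l)\<^sup>2 / ((1 + l) ^ 4 * (1 + l)\<^sup>2) = 6 * l / (1 + l) ^ 4 / y"
        using that by (subst mult_divide_mult_cancel_right) auto
      ultimately show ?thesis by (simp only:)
    qed
    have "((\<lambda>y. (ln y)\<^sup>2 * (ln y + 3) / (1 + ln y) ^ 3) has_real_derivative
        6 * ln y / (1 + ln y) ^ 4 / y) (at y)"
      unfolding e[OF p, symmetric] using y p
      by (auto intro!: derivative_eq_intros simp: power2_eq_square)
    from DERIV_divide[OF this DERIV_ident]
    show "((\<lambda>y. (ln y)\<^sup>2 * (ln y + 3) / (1 + ln y) ^ 3 / y) has_real_derivative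
        (6 * ln y / (1 + ln y) ^ 4 - (ln y)\<^sup>2 * (ln y + 3) / (1 + ln y) ^ 3) / y\<^sup>2) (at y)"
      using y by (simp add: power2_eq_square)
  qed auto
  then show ?thesis by (simp add: slog'_def[abs_def] slog''_def)
qed

lemma continuous_slog'': "continuous_on UNIV slog''"
proof -
  have "1 + ln (max 1 y) \<noteq> 0" for y :: real
    using ln_ge_zero[of "max 1 y"] by linarith
  moreover have "max 1 y \<noteq> 0" for y :: real by (auto simp: max_def)
  ultimately show ?thesis
    unfolding slog''_def[abs_def] by (intro continuous_intros) auto
qed

lemma slog_bounds: "0 \<le> slog y" "slog y \<le> ln (max 1 y)"
proof -
  define l where "l = ln (max 1 y)"
  have l: "0 \<le> l" unfolding l_def by (intro ln_ge_zero) auto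
  then show "0 \<le> slog y" unfolding slog_def l_def[symmetric] by simp
  have "l ^ 3 \<le> l * (1 + l)\<^sup>2"
    using l by (simp add: power2_eq_square power3_eq_cube algebra_simps)
  then show "slog y \<le> ln (max 1 y)"
    using l unfolding slog_def l_def[symmetric] by (simp add: divide_le_eq)
qed

text \<open>The smoothing leaves the positivity set of \<open>log^+\<close> unchanged, which keeps
  the supports for \<open>f\<close> and \<open>g\<close> disjoint.\<close>

lemma slog_pos_iff: "0 < slog y \<longleftrightarrow> 1 < y"
proof (cases "1 < y")
  case True
  then have "0 < ln y" by simp
  then have "0 < ln y ^ 3 / (1 + ln y)\<^sup>2" by (intro divide_pos_pos zero_less_power) auto
  with True show ?thesis by (simp add: slog_def max_def)
qed (simp add: slog_def max_def)

text \<open>For \<open>y \<ge> 1\<close> and \<open>l = ln y\<close> the sum is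
  \<open>\<psi>''(l) / y\<close>, where \<open>\<psi> x = x^3 / (1 + x)^2\<close> has
  \<open>\<psi>''(l) = 6 * l / (1 + l)^4\<close>. It is the factor by which the Laplacian of
  \<open>slog (|F|^2)\<close> differs from \<open>4 |F'|^2\<close>.\<close>

lemma slog_subharmonic: "0 \<le> slog' y + y * slog'' y"
proof (cases "1 \<le> y")
  case True
  define l where "l = ln y"
  have l: "0 \<le> l" using True by (simp add: l_def)
  define A where "A = l\<^sup>2 * (l + 3) / (1 + l) ^ 3"
  define B where "B = 6 * l / (1 + l) ^ 4"
  have "slog' y = A / y" "slog'' y = (B - A) / y\<^sup>2"
    using True by (simp_all add: slog'_def slog''_def max_absorb2 A_def B_def l_def)
  then have "slog' y + y * slog'' y = B / y"
    using True by (simp add: field_simps power2_eq_square)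
  then show ?thesis using l True by (simp add: B_def)
qed (simp add: slog'_def slog''_def max_def)

text \<open>Intended for \<open>F w = h (z0 + exp w)\<close> with \<open>h\<close> entire: circles
  about \<open>z0\<close> become vertical segments of length \<open>2 * pi\<close>, and the period
  of \<open>exp\<close> becomes that of \<open>F\<close>.\<close>

lemma periodic_subharmonic_slog:
  fixes F :: "complex \<Rightarrow> complex"
  assumes hol: "F holomorphic_on UNIV" and per: "\<And>w. F (w + 2 * of_real pi * \<i>) = F w"
  shows "\<exists>ut us utt uss.
    periodic_subharmonic (\<lambda>t s. slog ((cmod (F (Complex t s)))\<^sup>2)) ut us utt uss"
proof -
  define F1 where "F1 = deriv F"
  define F2 where "F2 = deriv F1"
  have hol1: "F1 holomorphic_on UNIV" and hol2: "F2 holomorphic_on UNIV"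
    unfolding F1_def F2_def by (intro holomorphic_deriv hol open_UNIV)+
  have dF: "(F has_field_derivative F1 w) (at w)" "(F1 has_field_derivative F2 w) (at w)" for w
    unfolding F1_def F2_def using hol hol1
    by (auto intro: holomorphic_derivI simp: F1_def)
  have line_t: "((\<lambda>t. Complex t s) has_vector_derivative 1) (at t)" for t s
    unfolding Complex_eq by (auto intro!: derivative_eq_intros)
  have line_s: "((\<lambda>s. Complex t s) has_vector_derivative \<i>) (at s)" for t s
    unfolding Complex_eq by (auto intro!: derivative_eq_intros)
  note chain_t = field_vector_diff_chain_at[OF line_t, unfolded o_def]
  note chain_s = field_vector_diff_chain_at[OF line_s, unfolded o_def]
  have Re_d: "((\<lambda>x. Re (h x)) has_real_derivative Re h') (at x)"
    and Im_d: "((\<lambda>x. Im (h x)) has_real_derivative Im h') (at x)"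
    if "(h has_vector_derivative h') (at x)" for h :: "real \<Rightarrow> complex" and h' x
    using that by (auto simp: has_real_derivative_iff_has_vector_derivative
        intro: bounded_linear.has_vector_derivative[OF bounded_linear_Re]
          bounded_linear.has_vector_derivative[OF bounded_linear_Im])
  define R where "R t s = Re (F (Complex t s))" for t s
  define I where "I t s = Im (F (Complex t s))" for t s
  define R1 where "R1 t s = Re (F1 (Complex t s))" for t s
  define I1 where "I1 t s = Im (F1 (Complex t s))" for t s
  define R2 where "R2 t s = Re (F2 (Complex t s))" for t s
  define I2 where "I2 t s = Im (F2 (Complex t s))" for t s
  note defs = R_def I_def R1_def I1_def R2_def I2_def
  have d_t: "((\<lambda>t. R t s) has_real_derivative R1 t s) (at t)"
    "((\<lambda>t. I t s) has_real_derivative I1 t s) (at t)"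
    "((\<lambda>t. R1 t s) has_real_derivative R2 t s) (at t)"
    "((\<lambda>t. I1 t s) has_real_derivative I2 t s) (at t)" for t s
    unfolding defs
    using Re_d[OF chain_t[OF dF(1)]] Im_d[OF chain_t[OF dF(1)]]
      Re_d[OF chain_t[OF dF(2)]] Im_d[OF chain_t[OF dF(2)]] by simp_all
  \<comment> \<open>Differentiating along \<open>s\<close> brings a factor \<open>\<i>\<close>,
    which turns \<open>(Re, Im)\<close> into \<open>(- Im, Re)\<close>.\<close>
  have d_s: "((\<lambda>s. R t s) has_real_derivative - I1 t s) (at s)"
    "((\<lambda>s. I t s) has_real_derivative R1 t s) (at s)"
    "((\<lambda>s. R1 t s) has_real_derivative - I2 t s) (at s)"
    "((\<lambda>s. I1 t s) has_real_derivative R2 t s) (at s)" for t s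
    unfolding defs
    using Re_d[OF chain_s[OF dF(1)]] Im_d[OF chain_s[OF dF(1)]]
      Re_d[OF chain_s[OF dF(2)]] Im_d[OF chain_s[OF dF(2)]] by simp_all
  have contC: "continuous_on UNIV (\<lambda>x. h (Complex (fst x) (snd x)))"
    if "h holomorphic_on UNIV" for h
    by (rule continuous_on_compose2[OF holomorphic_on_imp_continuous_on[OF that]])
      (auto simp: Complex_eq intro!: continuous_intros)
  have contR: "continuous_on UNIV (\<lambda>x. R (fst x) (snd x))" "continuous_on UNIV (\<lambda>x. I (fst x) (snd x))"
     "continuous_on UNIV (\<lambda>x. R1 (fst x) (snd x))" "continuous_on UNIV (\<lambda>x. I1 (fst x) (snd x))"
     "continuous_on UNIV (\<lambda>x. R2 (fst x) (snd x))" "continuous_on UNIV (\<lambda>x. I2 (fst x) (snd x))"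
    unfolding defs by (intro continuous_intros contC hol hol1 hol2)+
  define P where "P t s = (R t s)\<^sup>2 + (I t s)\<^sup>2" for t s
  define Pt where "Pt t s = 2 * (R t s * R1 t s + I t s * I1 t s)" for t s
  define Ps where "Ps t s = 2 * (I t s * R1 t s - R t s * I1 t s)" for t s
  define Ptt where "Ptt t s = 2 * ((R1 t s)\<^sup>2 + (I1 t s)\<^sup>2 + R t s * R2 t s + I t s * I2 t s)" for t s
  define Pss where "Pss t s = 2 * ((R1 t s)\<^sup>2 + (I1 t s)\<^sup>2 - R t s * R2 t s - I t s * I2 t s)" for t s
  note Pdefs = P_def Pt_def Ps_def Ptt_def Pss_def
  have P: "P t s = (cmod (F (Complex t s)))\<^sup>2" for t s
    by (simp add: P_def cmod_power2 R_def I_def)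
  have dP: "((\<lambda>t. P t s) has_real_derivative Pt t s) (at t)"
    "((\<lambda>t. Pt t s) has_real_derivative Ptt t s) (at t)"
    "((\<lambda>s. P t s) has_real_derivative Ps t s) (at s)"
    "((\<lambda>s. Ps t s) has_real_derivative Pss t s) (at s)" for t s
    unfolding Pdefs
    by (rule derivative_eq_intros d_t d_s refl | simp add: power2_eq_square algebra_simps)+
  have contP: "continuous_on UNIV (\<lambda>x. P (fst x) (snd x))" "continuous_on UNIV (\<lambda>x. Pt (fst x) (snd x))"
     "continuous_on UNIV (\<lambda>x. Ps (fst x) (snd x))" "continuous_on UNIV (\<lambda>x. Ptt (fst x) (snd x))"
     "continuous_on UNIV (\<lambda>x. Pss (fst x) (snd x))"
    unfolding Pdefs by (intro continuous_intros contR)+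
  have perC: "Complex t (s + 2 * pi) = Complex t s + 2 * of_real pi * \<i>" for t s
    by (simp add: complex_eq_iff)
  have per': "F1 (w + 2 * of_real pi * \<i>) = F1 w" for w
  proof -
    have "((\<lambda>w. F (w + 2 * of_real pi * \<i>)) has_field_derivative F1 (w + 2 * of_real pi * \<i>)) (at w)"
      using dF(1)[of "w + 2 * of_real pi * \<i>"] by (subst (asm) DERIV_shift) simp
    then show ?thesis using dF(1)[of w] per by (auto dest: DERIV_unique)
  qed
  have perP: "P t (s + 2 * pi) = P t s" "Ps t (s + 2 * pi) = Ps t s" for t s
    by (simp_all add: Pdefs defs perC per per')
  define ut where "ut t s = slog' (P t s) * Pt t s" for t s
  define us where "us t s = slog' (P t s) * Ps t s" for t s
  define utt where "utt t s = slog'' (P t s) * (Pt t s)\<^sup>2 + slog' (P t s) * Ptt t s" for t s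
  define uss where "uss t s = slog'' (P t s) * (Ps t s)\<^sup>2 + slog' (P t s) * Pss t s" for t s
  have cslog: "continuous_on UNIV slog" "continuous_on UNIV slog'"
    using DERIV_slog DERIV_slog' by (meson DERIV_continuous_on has_field_derivative_at_within)+
  have cs: "continuous_on UNIV (\<lambda>x. slog (P (fst x) (snd x)))"
     "continuous_on UNIV (\<lambda>x. slog' (P (fst x) (snd x)))"
     "continuous_on UNIV (\<lambda>x. slog'' (P (fst x) (snd x)))"
    using cslog continuous_slog'' contP(1) by (auto intro: continuous_on_compose2)
  have "periodic_subharmonic (\<lambda>t s. slog (P t s)) ut us utt uss"
  proof
    fix t s
    show "((\<lambda>t. slog (P t s)) has_real_derivative ut t s) (at t)"
      unfolding ut_def by (rule DERIV_chain2[OF DERIV_slog dP(1)])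
    show "((\<lambda>s. slog (P t s)) has_real_derivative us t s) (at s)"
      unfolding us_def by (rule DERIV_chain2[OF DERIV_slog dP(3)])
    show "((\<lambda>t. ut t s) has_real_derivative utt t s) (at t)"
      unfolding ut_def utt_def
      using DERIV_mult[OF DERIV_chain2[OF DERIV_slog' dP(1)] dP(2)]
      by (simp add: power2_eq_square algebra_simps)
    show "((\<lambda>s. us t s) has_real_derivative uss t s) (at s)"
      unfolding us_def uss_def
      using DERIV_mult[OF DERIV_chain2[OF DERIV_slog' dP(3)] dP(4)]
      by (simp add: power2_eq_square algebra_simps)
    \<comment> \<open>The second derivatives of \<open>F\<close> cancel in
      \<open>Ptt + Pss = 4 |F'|^2\<close>, while \<open>Pt^2 + Ps^2 = 4 P |F'|^2\<close>.\<close>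
    have "utt t s + uss t s = 4 * ((R1 t s)\<^sup>2 + (I1 t s)\<^sup>2) * (slog' (P t s) + P t s * slog'' (P t s))"
      unfolding utt_def uss_def Pt_def Ps_def Ptt_def Pss_def
      by (simp add: P_def power2_eq_square algebra_simps)
    then show "0 \<le> utt t s + uss t s"
      using slog_subharmonic[of "P t s"] by simp
    show "0 \<le> slog (P t s)" by (rule slog_bounds)
    show "slog (P t (s + 2 * pi)) = slog (P t s)" "us t (s + 2 * pi) = us t s"
      by (simp_all add: us_def perP)
  next
    show "continuous_on UNIV (case_prod (\<lambda>t s. slog (P t s)))" "continuous_on UNIV (case_prod ut)"
      "continuous_on UNIV (case_prod us)" "continuous_on UNIV (case_prod utt)"
      "continuous_on UNIV (case_prod uss)"
      unfolding case_prod_beta' ut_def us_def utt_def uss_def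
      by (intro continuous_intros cs contP)+
  qed
  then show ?thesis unfolding P by blast
qed

subsection \<open>Two entire functions\<close>

text \<open>Otherwise \<open>|f| > 1\<close> and \<open>|g| > 1\<close> would disconnect the plane.
  The point found is the common centre of all circles; both smoothed logarithms vanish
  there.\<close>

lemma common_small_point:
  fixes f g :: "complex \<Rightarrow> complex"
  assumes hol: "f holomorphic_on UNIV" "g holomorphic_on UNIV"
    and min: "\<And>z. min (cmod (f z)) (cmod (g z)) \<le> 1"
    and big: "1 < cmod (f a)" "1 < cmod (g b)"
  obtains z where "cmod (f z) \<le> 1" "cmod (g z) \<le> 1"
proof (rule ccontr)
  assume "\<not> thesis"
  then have "UNIV \<subseteq> {z. 1 < cmod (f z)} \<union> {z. 1 < cmod (g z)}"
    using that by (force simp: not_le)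
  moreover have "open {z. 1 < cmod (f z)}" "open {z. 1 < cmod (g z)}"
    using hol by (auto intro!: open_Collect_less continuous_intros holomorphic_on_imp_continuous_on)
  moreover have "{z. 1 < cmod (f z)} \<inter> {z. 1 < cmod (g z)} \<inter> UNIV = {}"
  proof -
    have "\<not> (1 < cmod (f z) \<and> 1 < cmod (g z))" for z
      using min[of z] by auto
    then show ?thesis by blast
  qed
  ultimately show False
    using big connected_UNIV[where 'a=complex] unfolding connected_def by blast
qed

text \<open>Contrapositive of Liouville's theorem.\<close>

lemma nonconstant_entire_exceeds:
  fixes f :: "complex \<Rightarrow> complex"
  assumes "f holomorphic_on UNIV" "\<not> f constant_on UNIV"
  obtains a where "M < cmod (f a)"
proof (rule ccontr)
  assume "\<not> thesis"
  then have "\<And>z. cmod (f z) \<le> M" using that by (meson not_le)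
  then have "bounded (range f)" by (auto simp: bounded_iff)
  then show False using assms Liouville_theorem[OF assms(1)] by (auto simp: constant_on_def)
qed

section \<open>Growth of the circular means\<close>

text \<open>The mean is positive on the circle through \<open>a\<close> and, as the smoothed
  logarithm vanishes at the centre \<open>z0\<close>, smaller on a sufficiently small circle. The
  mean value theorem gives a positive derivative in between.\<close>

lemma mass_eventually_increasing:
  fixes f :: "complex \<Rightarrow> complex"
  assumes hol: "f holomorphic_on UNIV" and z0: "cmod (f z0) \<le> 1" and a: "1 < cmod (f a)"
    and per: "periodic_subharmonic
      (\<lambda>t s. slog ((cmod (f (z0 + exp (Complex t s))))\<^sup>2)) ut us utt uss"
  obtains t0 where "0 < periodic_subharmonic.mass'
    (\<lambda>t s. slog ((cmod (f (z0 + exp (Complex t s))))\<^sup>2)) ut t0"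
proof -
  define u where "u t s = slog ((cmod (f (z0 + exp (Complex t s))))\<^sup>2)" for t s
  interpret periodic_subharmonic u ut us utt uss
    using per by (simp add: u_def[abs_def])
  have "a \<noteq> z0" using a z0 by auto
  define t1 where "t1 = ln (cmod (a - z0))"
  have "exp (Complex t1 (Arg2pi (a - z0))) = a - z0"
    using Arg2pi_eq[of "a - z0"] \<open>a \<noteq> z0\<close>
    by (simp add: Complex_eq exp_add t1_def exp_of_real)
  then have "0 < u t1 (Arg2pi (a - z0))"
    using a by (simp add: u_def slog_pos_iff one_less_power)
  then have m1: "0 < mass t1"
    using Arg2pi[of "a - z0"] by (intro mass_pos) auto
  \<comment> \<open>Chosen so that \<open>2 * pi * \<epsilon>^2\<close> is half of
    \<open>mass t1\<close>.\<close>
  define \<epsilon> where "\<epsilon> = sqrt (mass t1 / (4 * pi))"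
  have \<epsilon>: "0 < \<epsilon>" "2 * pi * \<epsilon>\<^sup>2 < mass t1"
    using m1 by (auto simp: \<epsilon>_def)
  have c: "continuous_on UNIV f" "continuous_on UNIV slog"
    using hol holomorphic_on_imp_continuous_on DERIV_slog
    by (blast, meson DERIV_continuous_on has_field_derivative_at_within)
  have "isCont (\<lambda>z. slog ((cmod (f z))\<^sup>2)) z0"
    using continuous_on_compose2[OF c(2), of UNIV "\<lambda>z. (cmod (f z))\<^sup>2"] c(1)
    by (simp add: continuous_on_eq_continuous_at continuous_intros)
  moreover have "slog ((cmod (f z0))\<^sup>2) = 0"
    using slog_pos_iff slog_bounds(1) z0 by (metis abs_norm_cancel abs_square_le_1 not_le order_le_less)
  ultimately obtain d where d: "0 < d"
    and small: "\<And>z. dist z z0 < d \<Longrightarrow> slog ((cmod (f z))\<^sup>2) < \<epsilon>"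
    using \<epsilon>(1) unfolding continuous_at_eps_delta dist_real_def
    by (metis abs_less_iff diff_zero)
  \<comment> \<open>The first entry puts \<open>t2\<close> before \<open>t1\<close>; the second puts
    the circle inside the disc of radius \<open>d\<close>.\<close>
  define t2 where "t2 = min (t1 - 1) (ln (d / 2))"
  have "exp t2 < d"
  proof -
    have "exp t2 \<le> exp (ln (d / 2))" unfolding exp_le_cancel_iff t2_def by simp
    then show ?thesis using d by simp
  qed
  then have "u t2 s \<le> \<epsilon>" for s
    unfolding u_def by (intro less_imp_le small) (simp add: dist_norm)
  then have "mass t2 < mass t1"
    using mass_le[of t2 \<epsilon>] \<epsilon>(2) by fastforce
  moreover have "t2 < t1" by (simp add: t2_def)
  then obtain \<xi> where "mass t1 - mass t2 = (t1 - t2) * mass' \<xi>"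
    using MVT2[of t2 t1 mass mass'] DERIV_mass by blast
  moreover have "0 < t1 - t2" using \<open>t2 < t1\<close> by simp
  ultimately have "0 < mass' \<xi>" by (metis diff_gt_0_iff_gt zero_less_mult_pos)
  then show thesis using that by (simp add: u_def[abs_def])
qed

text \<open>On the circle \<open>|f|^2 \<le> exp (2 * (K + B * exp t))\<close>, where
  \<open>K\<close> absorbs \<open>A\<close> and the offset \<open>z0\<close>. Once
  \<open>K \<le> B * exp t\<close>, the smoothed logarithm is at most \<open>4 * B * exp t\<close>,
  so a small type \<open>B\<close> gives a small factor.\<close>

lemma mass_growth:
  fixes f :: "complex \<Rightarrow> complex"
  assumes bd: "\<And>z. cmod (f z) \<le> A * exp (B * cmod z)" and A: "0 < A" and B: "0 < B"
    and per: "periodic_subharmonic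
      (\<lambda>t s. slog ((cmod (f (z0 + exp (Complex t s))))\<^sup>2)) ut us utt uss"
  shows "eventually (\<lambda>t. periodic_subharmonic.mass
    (\<lambda>t s. slog ((cmod (f (z0 + exp (Complex t s))))\<^sup>2)) t \<le> 2 * pi * (4 * B * exp t)\<^sup>2) at_top"
proof -
  define u where "u t s = slog ((cmod (f (z0 + exp (Complex t s))))\<^sup>2)" for t s
  interpret periodic_subharmonic u ut us utt uss
    using per by (simp add: u_def[abs_def])
  define K where "K = max 0 (ln A) + B * cmod z0"
  have "filterlim (\<lambda>t. B * exp t) at_top at_top"
    using B by (intro filterlim_tendsto_pos_mult_at_top[OF tendsto_const _ exp_at_top])
  then have "eventually (\<lambda>t. K \<le> B * exp t) at_top"
    by (simp add: filterlim_at_top)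
  then have "eventually (\<lambda>t. mass t \<le> 2 * pi * (4 * B * exp t)\<^sup>2) at_top"
  proof eventually_elim
    case (elim t)
    show ?case
    proof (rule mass_le)
      fix s
      define z where "z = z0 + exp (Complex t s)"
      have K0: "0 \<le> K" using B by (simp add: K_def)
      have nz: "cmod z \<le> cmod z0 + exp t"
        unfolding z_def using norm_triangle_ineq[of z0 "exp (Complex t s)"] by simp
      have "cmod (f z) \<le> A * exp (B * cmod z)" by (rule bd)
      also have "\<dots> \<le> exp (max 0 (ln A)) * exp (B * (cmod z0 + exp t))"
      proof (intro mult_mono)
        have "A = exp (ln A)" using A by simp
        also have "\<dots> \<le> exp (max 0 (ln A))" unfolding exp_le_cancel_iff by simp
        finally show "A \<le> exp (max 0 (ln A))" .
        show "exp (B * cmod z) \<le> exp (B * (cmod z0 + exp t))"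
          using B nz by simp
      qed auto
      also have "\<dots> = exp (K + B * exp t)"
        by (simp add: K_def algebra_simps flip: exp_add)
      also have "\<dots> \<le> exp (2 * B * exp t)" using elim by simp
      finally have "(cmod (f z))\<^sup>2 \<le> (exp (2 * B * exp t))\<^sup>2"
        by (intro power_mono) auto
      also have "\<dots> = exp (4 * B * exp t)"
        by (simp add: power2_eq_square flip: exp_add)
      finally have "max 1 ((cmod (f z))\<^sup>2) \<le> exp (4 * B * exp t)"
        using B by simp
      then have "ln (max 1 ((cmod (f z))\<^sup>2)) \<le> ln (exp (4 * B * exp t))"
        by (intro ln_mono) auto
      then show "u t s \<le> 4 * B * exp t"
        using slog_bounds(2)[of "(cmod (f z))\<^sup>2"] by (simp add: u_def z_def)
    qed
  qed
  then show ?thesis by (simp add: u_def[abs_def])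
qed

theorem theorem1p1:
  fixes f g :: "complex \<Rightarrow> complex"
  assumes "f holomorphic_on UNIV" and "g holomorphic_on UNIV"
    and "minimal_exponential_type f" and "finite_exponential_type g"
    and "(SUP z. ereal (min (norm (f z)) (norm (g z)))) \<le> 1"
  shows "f constant_on UNIV \<or> g constant_on UNIV"
proof (rule ccontr)
  assume "\<not> ?thesis"
  then obtain a b where big: "1 < cmod (f a)" "1 < cmod (g b)"
    using nonconstant_entire_exceeds assms(1,2) by metis
  \<comment> \<open>The supremum is taken in \<open>ereal\<close>, where it is an upper bound of
    every family.\<close>
  have min: "min (cmod (f z)) (cmod (g z)) \<le> 1" for z
  proof -
    have "ereal (min (cmod (f z)) (cmod (g z))) \<le> 1"
      using assms(5) by (meson SUP_le_iff UNIV_I)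
    then show ?thesis by (simp only: one_ereal_def ereal_less_eq)
  qed
  obtain z0 where z0: "cmod (f z0) \<le> 1" "cmod (g z0) \<le> 1"
    using common_small_point[OF assms(1,2) min big] by blast
  define u where "u t s = slog ((cmod (f (z0 + exp (Complex t s))))\<^sup>2)" for t s
  define v where "v t s = slog ((cmod (g (z0 + exp (Complex t s))))\<^sup>2)" for t s
  have ex: "\<exists>ut us utt uss. periodic_subharmonic
      (\<lambda>t s. slog ((cmod (h (z0 + exp (Complex t s))))\<^sup>2)) ut us utt uss"
    if "h holomorphic_on UNIV" for h
  proof (rule periodic_subharmonic_slog)
    have "(h \<circ> (\<lambda>w. z0 + exp w)) holomorphic_on UNIV"
    proof (rule holomorphic_on_compose)
      show "(\<lambda>w. z0 + exp w) holomorphic_on UNIV" by (intro holomorphic_intros)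
      show "h holomorphic_on (\<lambda>w. z0 + exp w) ` UNIV"
        using that holomorphic_on_subset by blast
    qed
    then show "(\<lambda>w. h (z0 + exp w)) holomorphic_on UNIV" by (simp only: o_def)
    show "h (z0 + exp (w + 2 * of_real pi * \<i>)) = h (z0 + exp w)" for w
      by (simp only: exp_add exp_two_pi_i mult_1_right)
  qed
  obtain ut us utt uss where U: "periodic_subharmonic u ut us utt uss"
    using ex[OF assms(1)] unfolding u_def[abs_def] by blast
  obtain vt vs vtt vss where V: "periodic_subharmonic v vt vs vtt vss"
    using ex[OF assms(2)] unfolding v_def[abs_def] by blast
  interpret U: periodic_subharmonic u ut us utt uss by fact
  interpret V: periodic_subharmonic v vt vs vtt vss by fact
  have disj: "u t s * v t s = 0" for t s
  proof -
    have "\<not> (1 < cmod (f z) \<and> 1 < cmod (g z))" for z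
      using min[of z] by auto
    moreover have "1 < cmod w" if "1 < (cmod w)\<^sup>2" for w
      using that abs_square_le_1[of "cmod w"] by auto
    ultimately have "\<not> (0 < u t s \<and> 0 < v t s)"
      unfolding u_def v_def slog_pos_iff by blast
    then show ?thesis using U.nonneg[of t s] V.nonneg[of t s] by auto
  qed
  obtain tu where tu: "0 < U.mass' tu"
    using mass_eventually_increasing[OF assms(1) z0(1) big(1) U[unfolded u_def[abs_def]]]
    by (auto simp: u_def[abs_def])
  obtain tv where tv: "0 < V.mass' tv"
    using mass_eventually_increasing[OF assms(2) z0(2) big(2) V[unfolded v_def[abs_def]]]
    by (auto simp: v_def[abs_def])
  \<comment> \<open>Both derivatives are nondecreasing, so their positivity persists to a common
    starting point.\<close>
  define t0 where "t0 = max tu tv"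
  have "0 < U.mass' t0" "0 < V.mass' t0"
    using tu tv U.mass'_mono[of tu t0] V.mass'_mono[of tv t0] by (auto simp: t0_def)
  then obtain q where q: "0 < q" "\<And>t. t0 \<le> t \<Longrightarrow> q * exp (4 * t) \<le> U.mass (t + 1) * V.mass (t + 1)"
    using two_phase_lower_bound[OF U V disj] by blast
  obtain B A where B: "0 < A" "0 < B" "\<And>z. cmod (g z) \<le> A * exp (B * cmod z)"
    using assms(4) unfolding finite_exponential_type_def by blast
  have gV: "eventually (\<lambda>t. V.mass t \<le> 2 * pi * (4 * B * exp t)\<^sup>2) at_top"
    using mass_growth[OF B(3,1,2) V[unfolded v_def[abs_def]]] by (simp add: v_def[abs_def])
  \<comment> \<open>Collects the constants of the two growth bounds; \<open>exp 4\<close> pays for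
    the shift from \<open>t - 1\<close> to \<open>t\<close>. It depends on \<open>B\<close> but not
    on \<open>\<epsilon>\<close>.\<close>
  define C where "C = (32 * pi * B)\<^sup>2 * exp 4"
  have C: "0 < C" using B by (simp add: C_def)
  \<comment> \<open>Minimal type allows any \<open>\<epsilon>\<close>, while \<open>q\<close> and
    \<open>C\<close> are already fixed. Both bounds on the product grow like
    \<open>exp (4 * t)\<close>, so one large \<open>t\<close> compares their constants.\<close>
  have main: "q \<le> C * \<epsilon>\<^sup>2" if \<epsilon>: "0 < \<epsilon>" for \<epsilon>
  proof -
    obtain A' where A': "0 < A'" "\<And>z. cmod (f z) \<le> A' * exp (\<epsilon> * cmod z)"
      using assms(3) \<epsilon> unfolding minimal_exponential_type_def by blast
    have "eventually (\<lambda>t. U.mass t \<le> 2 * pi * (4 * \<epsilon> * exp t)\<^sup>2) at_top"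
      using mass_growth[OF A'(2,1) \<epsilon> U[unfolded u_def[abs_def]]] by (simp add: u_def[abs_def])
    with gV have "eventually (\<lambda>t. U.mass t \<le> 2 * pi * (4 * \<epsilon> * exp t)\<^sup>2 \<and>
        V.mass t \<le> 2 * pi * (4 * B * exp t)\<^sup>2 \<and> t0 + 1 \<le> t) at_top"
      by (intro eventually_conj eventually_ge_at_top)
    then obtain t where t: "U.mass t \<le> 2 * pi * (4 * \<epsilon> * exp t)\<^sup>2"
      "V.mass t \<le> 2 * pi * (4 * B * exp t)\<^sup>2" "t0 + 1 \<le> t"
      using eventually_happens'[OF trivial_limit_at_top_linorder] by blast
    have "q * exp (4 * (t - 1)) \<le> U.mass t * V.mass t"
      using q(2)[of "t - 1"] t(3) by simp
    also have "\<dots> \<le> (2 * pi * (4 * \<epsilon> * exp t)\<^sup>2) * (2 * pi * (4 * B * exp t)\<^sup>2)"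
      using t U.mass_nonneg V.mass_nonneg by (intro mult_mono) auto
    also have "\<dots> = (32 * pi * B)\<^sup>2 * \<epsilon>\<^sup>2 * (exp t) ^ 4"
      by algebra
    also have "(exp t) ^ 4 = exp 4 * exp (4 * (t - 1))"
    proof -
      have "(exp t) ^ 4 = exp (of_nat 4 * t)" by (rule exp_of_nat_mult[symmetric])
      also have "\<dots> = exp (4 + 4 * (t - 1))" by (simp add: algebra_simps)
      finally show ?thesis by (simp only: exp_add)
    qed
    finally have "q * exp (4 * (t - 1)) \<le> (C * \<epsilon>\<^sup>2) * exp (4 * (t - 1))"
      by (simp only: C_def mult_ac)
    then show ?thesis by (rule mult_right_le_imp_le) simp
  qed
  \<comment> \<open>With this \<open>\<epsilon>\<close> the right side equals
    \<open>q / 2\<close>.\<close>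
  have "q \<le> C * (sqrt (q / (2 * C)))\<^sup>2"
    using q(1) C by (intro main) simp
  then show False using q(1) C by simp
qed

end
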